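(* Let $n \geq 0$ and $m \geq 1$ be integers, and let $a_1,\ldots,a_n$ and $b_1,\ldots,b_m$ be positive integers. Then there exists an upho poset $P$ whose rank-generating function is $$F_P(x)=\frac{(1+a_1x)(1+a_2x)\cdots(1+a_nx)}{(1-b_1x)(1-b_2x)\cdots(1-b_mx)}.$$
   Context: A poset $P$ is ranked if it has a disjoint decomposition $P=P_0\sqcup P_1\sqcup P_2\sqcup\cdots$ such that whenever $x\in P_i$ and $y$ covers $x$, then $y\in P_{i+1}$. It is of finite type if every $P_i$ is finite. Its rank-generating function is $F_P(x)=\sum_{k\ge 0}|P_k|x^k$. For $s\in P$, the principal order filter is $V_{P,s}=\{t\in P: t\ge s\}$. A ranked poset $P$ is upho (upper homogeneous finite) if it is of finite type and $V_{P,s}\cong P$ (as posets) for every $s\in P$. *)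

theory Defs
  imports
    "HOL-Computational_Algebra.Formal_Power_Series"
    "HOL-Library.Disjoint_Sets"
begin

text \<open>
  A poset is a carrier set \<open>A\<close> with a relation \<open>r\<close> such that \<^term>\<open>partial_order_on A r\<close>;
  \<open>(x, y) \<in> r\<close> means \<open>x \<le> y\<close>.
\<close>

definition covers :: "'a rel \<Rightarrow> 'a \<Rightarrow> 'a \<Rightarrow> bool" where
  "covers r y x \<longleftrightarrow> (x, y) \<in> r \<and> x \<noteq> y \<and> (\<forall>z. (x, z) \<in> r \<and> (z, y) \<in> r \<longrightarrow> z = x \<or> z = y)"

definition ranked_poset :: "'a set \<Rightarrow> 'a rel \<Rightarrow> (nat \<Rightarrow> 'a set) \<Rightarrow> bool" where
  "ranked_poset A r R \<longleftrightarrow>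
     partial_order_on A r \<and>
     (\<Union>i. R i) = A \<and> disjoint_family R \<and>
     (\<forall>i x y. x \<in> R i \<and> covers r y x \<longrightarrow> y \<in> R (Suc i))"

definition finite_type :: "(nat \<Rightarrow> 'a set) \<Rightarrow> bool" where
  "finite_type R \<longleftrightarrow> (\<forall>i. finite (R i))"

definition locally_finite_poset :: "'a set \<Rightarrow> 'a rel \<Rightarrow> bool" where
  "locally_finite_poset A r \<longleftrightarrow> (\<forall>x\<in>A. \<forall>y\<in>A. finite {z \<in> A. (x, z) \<in> r \<and> (z, y) \<in> r})"

definition principal_filter :: "'a set \<Rightarrow> 'a rel \<Rightarrow> 'a \<Rightarrow> 'a set" where
  "principal_filter A r s = {t \<in> A. (s, t) \<in> r}"

definition poset_isomorphic :: "'a set \<Rightarrow> 'a rel \<Rightarrow> 'b set \<Rightarrow> 'b rel \<Rightarrow> bool" where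
  "poset_isomorphic A r B q \<longleftrightarrow>
     (\<exists>f. bij_betw f A B \<and> (\<forall>x\<in>A. \<forall>y\<in>A. (x, y) \<in> r \<longleftrightarrow> (f x, f y) \<in> q))"

text \<open>
  Local finiteness is the usual standing convention for ranked posets and must be explicit here:
  the rank condition constrains only covering pairs, so a dense order such as the nonnegative
  rationals, which has no covering pairs, would otherwise be upho with respect to every
  partition into finite sets.  By \<open>ranked_poset_strict_mono\<close> below, local finiteness makes
  the rank strictly increasing.
\<close>

definition upho :: "'a set \<Rightarrow> 'a rel \<Rightarrow> (nat \<Rightarrow> 'a set) \<Rightarrow> bool" where
  "upho A r R \<longleftrightarrow>
     ranked_poset A r R \<and> locally_finite_poset A r \<and> finite_type R \<and>
     (\<forall>s\<in>A. poset_isomorphic (principal_filter A r s)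
               (r \<inter> principal_filter A r s \<times> principal_filter A r s) A r)"

definition rank_gen_fun :: "(nat \<Rightarrow> 'a set) \<Rightarrow> rat fps" where
  "rank_gen_fun R = Abs_fps (\<lambda>k. of_nat (card (R k)))"

lemma ranked_poset_strict_mono:
  assumes "ranked_poset A r R" "locally_finite_poset A r"
    and "(x, y) \<in> r" "x \<noteq> y" "x \<in> R i" "y \<in> R j"
  shows "i < j"
  using assms(3-6)
proof (induction "card {z \<in> A. (x, z) \<in> r \<and> (z, y) \<in> r}" arbitrary: x y i j rule: less_induct)
  case less
  let ?I = "\<lambda>x y. {z \<in> A. (x, z) \<in> r \<and> (z, y) \<in> r}"
  have po: "partial_order_on A r" and U: "(\<Union>i. R i) = A"
    and disj: "disjoint_family R"
    and cov: "\<And>i x y. x \<in> R i \<Longrightarrow> covers r y x \<Longrightarrow> y \<in> R (Suc i)"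
    using assms(1) unfolding ranked_poset_def by blast+
  have rA: "r \<subseteq> A \<times> A" and refl: "\<And>a. a \<in> A \<Longrightarrow> (a, a) \<in> r"
    and "trans r" "antisym r"
    using po unfolding partial_order_on_def preorder_on_def refl_on_def by blast+
  then have tr: "\<And>a b c. (a, b) \<in> r \<Longrightarrow> (b, c) \<in> r \<Longrightarrow> (a, c) \<in> r"
    and anti: "\<And>a b. (a, b) \<in> r \<Longrightarrow> (b, a) \<in> r \<Longrightarrow> a = b"
    by (meson transD, meson antisymD)
  have xy: "x \<in> A" "y \<in> A" using less.prems rA by auto
  have fin: "finite (?I x y)" using assms(2) xy by (auto simp: locally_finite_poset_def)
  show ?case
  proof (cases "covers r y x")
    case True
    with cov less.prems have "y \<in> R (Suc i)" by blast
    with disj less.prems(4) have "j = Suc i" by (auto simp: disjoint_family_on_def)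
    then show ?thesis by simp
  next
    case False
    then obtain z where z: "(x, z) \<in> r" "(z, y) \<in> r" "z \<noteq> x" "z \<noteq> y"
      using less.prems unfolding covers_def by blast
    then have "z \<in> A" using rA by auto
    then obtain k where k: "z \<in> R k" using U by blast
    have "?I x z \<subset> ?I x y"
    proof
      show "?I x z \<subseteq> ?I x y" using z tr by blast
      have "y \<in> ?I x y" "y \<notin> ?I x z" using less.prems xy refl anti[of y z] z by blast+
      then show "?I x z \<noteq> ?I x y" by blast
    qed
    moreover have "?I z y \<subset> ?I x y"
    proof
      show "?I z y \<subseteq> ?I x y" using z tr by blast
      have "x \<in> ?I x y" "x \<notin> ?I z y" using less.prems xy refl anti[of x z] z by blast+
      then show "?I z y \<noteq> ?I x y" by blast
    qed
    ultimately have "card (?I x z) < card (?I x y)" "card (?I z y) < card (?I x y)"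
      using fin psubset_card_mono by blast+
    then have "i < k" "k < j"
      using less.hyps[of x z i k] less.hyps[of z y k j] less.prems z k by simp_all
    then show ?thesis by simp
  qed
qed

end

theory Submission
  imports Defs "HOL-Library.Countable"
begin

unbundle fps_syntax

text \<open>
  A left-cancellative graded monoid that is generated in degree one and has finitely many elements
  in each degree is upho under left divisibility, because \<open>z \<mapsto> s z\<close> is an
  isomorphism onto the filter of \<open>s\<close>.  So it suffices to realise the series as the
  growth series of such a monoid.  A direct product with a free monoid on \<open>b\<close> letters divides the
  series by \<open>1 - b X\<close>.  To multiply it by \<open>1 + a X\<close>, fix an element \<open>x\<close> of degree one in \<open>M\<close> and
  adjoin new generators \<open>y\<^sub>1, \<dots>, y\<^sub>a\<close> subject to \<open>y\<^sub>i v = x v\<close> for all \<open>v \<noteq> 1\<close>: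
  the elements of the new monoid are \<open>m\<close> and \<open>m y\<^sub>i\<close> with \<open>m \<in> M\<close>.
\<close>

section \<open>Graded left-cancellative monoids and their divisibility order\<close>

definition level :: "'a set \<Rightarrow> ('a \<Rightarrow> nat) \<Rightarrow> nat \<Rightarrow> 'a set" where
  "level S deg k = {x \<in> S. deg x = k}"

lemma level_disjoint: "disjoint_family (level S deg)"
  by (auto simp: level_def disjoint_family_on_def)

text \<open>Cancellation is required on the left only: the relations
  \<open>y\<^sub>i v = x v\<close> for \<open>v \<noteq> 1\<close> with
  \<open>y\<^sub>i \<noteq> x\<close> violate it on the right.\<close>

locale graded_cancel_monoid =
  fixes S :: "'a set" and prd :: "'a \<Rightarrow> 'a \<Rightarrow> 'a" (infixl "\<cdot>" 70)
    and e :: 'a and deg :: "'a \<Rightarrow> nat"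
  assumes mult_closed [simp]: "x \<in> S \<Longrightarrow> y \<in> S \<Longrightarrow> x \<cdot> y \<in> S"
    and e_closed [simp]: "e \<in> S"
    and assoc: "x \<in> S \<Longrightarrow> y \<in> S \<Longrightarrow> z \<in> S \<Longrightarrow> x \<cdot> y \<cdot> z = x \<cdot> (y \<cdot> z)"
    and left_e [simp]: "x \<in> S \<Longrightarrow> e \<cdot> x = x"
    and right_e [simp]: "x \<in> S \<Longrightarrow> x \<cdot> e = x"
    and left_cancel: "x \<in> S \<Longrightarrow> y \<in> S \<Longrightarrow> z \<in> S \<Longrightarrow> x \<cdot> y = x \<cdot> z \<Longrightarrow> y = z"
    and deg_mult [simp]: "x \<in> S \<Longrightarrow> y \<in> S \<Longrightarrow> deg (x \<cdot> y) = deg x + deg y"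
    and deg_0: "x \<in> S \<Longrightarrow> deg x = 0 \<Longrightarrow> x = e"
    and generated: "x \<in> S \<Longrightarrow> deg x = Suc k \<Longrightarrow>
      \<exists>y\<in>S. \<exists>z\<in>S. deg y = k \<and> deg z = 1 \<and> x = y \<cdot> z"
    and finite_level: "finite (level S deg k)"
begin

lemma deg_e [simp]: "deg e = 0"
  using deg_mult[of e e] by simp

definition ldvd :: "'a rel" where
  "ldvd = {(x, y). x \<in> S \<and> y \<in> S \<and> (\<exists>z\<in>S. y = x \<cdot> z)}"

lemma ldvd_mult: "x \<in> S \<Longrightarrow> z \<in> S \<Longrightarrow> (x, x \<cdot> z) \<in> ldvd"
  by (auto simp: ldvd_def)

lemma ldvd_partial_order: "partial_order_on S ldvd"
proof -
  have "(x, x) \<in> ldvd" if "x \<in> S" for x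
    using ldvd_mult[OF that e_closed] that by simp
  then have "refl_on S ldvd"
    by (auto simp: refl_on_def)
  moreover have "trans ldvd"
    by (rule transI) (clarsimp simp: ldvd_def assoc, metis mult_closed)
  moreover have "antisym ldvd"
  proof (rule antisymI)
    fix x y assume "(x, y) \<in> ldvd" "(y, x) \<in> ldvd"
    then obtain z w where *: "x \<in> S" "y \<in> S" "z \<in> S" "w \<in> S" "y = x \<cdot> z" "x = y \<cdot> w"
      unfolding ldvd_def by blast
    then have "deg y = deg x + deg z" "deg x = deg y + deg w"
      using deg_mult by metis+
    then have "z = e"
      using *(3) deg_0 by simp
    then show "x = y"
      using *(1,5) right_e by metis
  qed
  moreover have "ldvd \<subseteq> S \<times> S"
    by (auto simp: ldvd_def)
  ultimately show ?thesis
    by (simp add: partial_order_on_def preorder_on_def)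
qed

text \<open>Write \<open>y = x \<cdot> z\<close> and split off a last factor of degree one,
  \<open>z = u \<cdot> v\<close>. Then \<open>x \<cdot> u\<close> lies between \<open>x\<close> and
  \<open>y\<close> in degree one below \<open>y\<close>, so the covering relation forces it to be
  \<open>x\<close>.\<close>

lemma covers_ldvd_deg:
  assumes "covers ldvd y x"
  shows "deg y = Suc (deg x)"
proof -
  obtain z where z: "x \<in> S" "z \<in> S" "y = x \<cdot> z" "x \<noteq> y"
    using assms by (auto simp: covers_def ldvd_def)
  then have "deg z \<noteq> 0"
    using deg_0[of z] right_e[of x] by metis
  then obtain k where k: "deg z = Suc k"
    by (cases "deg z") auto
  obtain u v where uv: "u \<in> S" "v \<in> S" "deg u = k" "deg v = 1" "z = u \<cdot> v"
    using generated[OF z(2) k] by blast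
  have "(x, x \<cdot> u) \<in> ldvd" "(x \<cdot> u, y) \<in> ldvd"
    using z uv ldvd_mult[of "x \<cdot> u" v] by (auto simp: assoc ldvd_mult)
  then have "x \<cdot> u = x \<or> x \<cdot> u = y"
    using assms by (auto simp: covers_def)
  then have "deg (x \<cdot> u) = deg x \<or> deg (x \<cdot> u) = deg y"
    by auto
  then show ?thesis
    using z uv by auto
qed

lemma filter_isomorphic:
  assumes s: "s \<in> S"
  shows "poset_isomorphic (principal_filter S ldvd s)
    (ldvd \<inter> principal_filter S ldvd s \<times> principal_filter S ldvd s) S ldvd"
proof -
  let ?V = "principal_filter S ldvd s"
  have V: "?V = (\<cdot>) s ` S"
    using s by (auto simp: principal_filter_def ldvd_def)
  have inj: "inj_on ((\<cdot>) s) S"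
    using s left_cancel by (auto intro: inj_onI)
  \<comment> \<open>\<open>upho\<close> asks for a map from the filter to the whole poset, hence the
    inverse of left multiplication by \<open>s\<close>.\<close>
  let ?f = "inv_into S ((\<cdot>) s)"
  have "bij_betw ?f ?V S"
    unfolding V using inj by (simp add: inj_on_imp_bij_betw bij_betw_inv_into)
  moreover have "(x, y) \<in> ldvd \<inter> ?V \<times> ?V \<longleftrightarrow> (?f x, ?f y) \<in> ldvd"
    if xy: "x \<in> ?V" "y \<in> ?V" for x y
  proof -
    obtain u v where uv: "u \<in> S" "v \<in> S" "x = s \<cdot> u" "y = s \<cdot> v"
      using xy V by auto
    then have "?f x = u" "?f y = v"
      using inj by simp_all
    moreover have "(s \<cdot> u, s \<cdot> v) \<in> ldvd \<longleftrightarrow> (u, v) \<in> ldvd"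
    proof
      assume "(s \<cdot> u, s \<cdot> v) \<in> ldvd"
      then obtain z where "z \<in> S" "s \<cdot> v = s \<cdot> (u \<cdot> z)"
        using s uv by (auto simp: ldvd_def assoc)
      then show "(u, v) \<in> ldvd"
        using s uv left_cancel[of s v "u \<cdot> z"] by (auto simp: ldvd_def)
    qed (use s uv in \<open>auto simp: ldvd_def assoc\<close>)
    ultimately show ?thesis
      using uv xy by simp
  qed
  ultimately show ?thesis
    unfolding poset_isomorphic_def by blast
qed

lemma ldvd_upho: "upho S ldvd (level S deg)"
proof -
  have "ranked_poset S ldvd (level S deg)"
    unfolding ranked_poset_def
  proof (intro conjI allI impI)
    show "(\<Union>i. level S deg i) = S"
      by (auto simp: level_def)
    fix i x y assume "x \<in> level S deg i \<and> covers ldvd y x"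
    then show "y \<in> level S deg (Suc i)"
      using covers_ldvd_deg by (auto simp: level_def covers_def ldvd_def)
  qed (rule ldvd_partial_order level_disjoint)+
  moreover have "locally_finite_poset S ldvd"
    unfolding locally_finite_poset_def
  proof (intro ballI)
    fix x y
    \<comment> \<open>A left divisor of \<open>y\<close> has degree at most \<open>deg y\<close>, so
      the interval lies in finitely many finite levels.\<close>
    have "{z \<in> S. (x, z) \<in> ldvd \<and> (z, y) \<in> ldvd} \<subseteq> (\<Union>k\<le>deg y. level S deg k)"
      by (auto simp: ldvd_def level_def)
    then show "finite {z \<in> S. (x, z) \<in> ldvd \<and> (z, y) \<in> ldvd}"
      by (rule finite_subset) (simp add: finite_level)
  qed
  ultimately show ?thesis
    by (simp add: upho_def finite_type_def finite_level filter_isomorphic)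
qed

section \<open>Constructions of new graded monoids\<close>

text \<open>Each construction below changes the element type. Transport along an injection
  \<open>h\<close> with left inverse \<open>g\<close> returns the carrier to a fixed type, so that
  the constructions can be iterated.\<close>

lemma transfer_left_inverse:
  fixes h :: "'a \<Rightarrow> 'b" and g :: "'b \<Rightarrow> 'a"
  assumes gh: "\<And>x. g (h x) = x"
  shows "graded_cancel_monoid (h ` S) (\<lambda>x y. h (g x \<cdot> g y)) (h e) (deg \<circ> g)"
    and "rank_gen_fun (level (h ` S) (deg \<circ> g)) = rank_gen_fun (level S deg)"
proof -
  have inj: "inj_on h A" for A
    using gh by (metis inj_onI)
  have lev: "level (h ` S) (deg \<circ> g) k = h ` level S deg k" for k
    by (auto simp: level_def gh)
  show "rank_gen_fun (level (h ` S) (deg \<circ> g)) = rank_gen_fun (level S deg)"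
    by (simp add: rank_gen_fun_def lev card_image inj)
  show "graded_cancel_monoid (h ` S) (\<lambda>x y. h (g x \<cdot> g y)) (h e) (deg \<circ> g)"
  proof (unfold_locales, goal_cases)
    case (6 x y z)
    then have "g x \<cdot> g y = g x \<cdot> g z"
      by (metis gh)
    moreover have "g x \<in> S" "g y \<in> S" "g z \<in> S" "h (g y) = y" "h (g z) = z"
      using 6 by (auto simp: gh)
    ultimately show ?case
      using left_cancel by metis
  next
    case (9 x k)
    then show ?case
      using generated by (fastforce simp: gh)
  qed (auto simp: gh assoc lev finite_level dest: deg_0)
qed

text \<open>A pair of positive degree either has the empty word or arises by prepending one of
  \<open>b\<close> letters to the word of a pair of degree one less. The resulting recurrence for
  the level sizes is the product identity read coefficientwise.\<close>

lemma times_free_monoid: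
  fixes b :: nat
  defines "S' \<equiv> S \<times> lists {..<b}"
    and "prd' \<equiv> (\<lambda>(m, l) (m', l'). (m \<cdot> m', l @ l'))"
    and "deg' \<equiv> (\<lambda>(m, l). deg m + length l)"
  shows "graded_cancel_monoid S' prd' (e, []) deg'"
    and "rank_gen_fun (level S' deg') * (1 - fps_const (of_nat b) * fps_X)
      = rank_gen_fun (level S deg)"
proof -
  have lev_0: "level S' deg' 0 = (\<lambda>m. (m, [])) ` level S deg 0"
    by (auto simp: level_def S'_def deg'_def)
  have lev_Suc: "level S' deg' (Suc k) = (\<lambda>m. (m, [])) ` level S deg (Suc k) \<union>
      (\<lambda>((m, l), c). (m, c # l)) ` (level S' deg' k \<times> {..<b})" (is "?L = ?A \<union> ?B") for k
  proof -
    have "(m, l) \<in> ?L \<longleftrightarrow> (m, l) \<in> ?A \<union> ?B" for m l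
      by (cases l) (auto simp: level_def S'_def deg'_def image_iff)
    then show ?thesis
      by (intro set_eqI) (metis surj_pair)
  qed
  have fin: "finite (level S' deg' k)" for k
    by (induction k) (auto simp: lev_0 lev_Suc finite_level)
  have card_0: "card (level S' deg' 0) = card (level S deg 0)"
    by (simp add: lev_0 card_image inj_on_def)
  have card_Suc: "card (level S' deg' (Suc k)) =
      card (level S deg (Suc k)) + b * card (level S' deg' k)" for k
  proof -
    have "inj_on (\<lambda>((m, l), c). (m, c # l)) (level S' deg' k \<times> {..<b})"
      by (auto simp: inj_on_def)
    from card_image[OF this] show ?thesis
      unfolding lev_Suc
      by (subst card_Un_disjoint)
        (auto simp: finite_level fin card_image inj_on_def card_cartesian_product)
  qed
  show "rank_gen_fun (level S' deg') * (1 - fps_const (of_nat b) * fps_X)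
      = rank_gen_fun (level S deg)" (is "?F * _ = _")
  proof (rule fps_ext)
    fix k
    have "?F * (1 - fps_const (of_nat b) * fps_X) = ?F - fps_const (of_nat b) * (fps_X * ?F)"
      by (simp add: algebra_simps)
    then show "(?F * (1 - fps_const (of_nat b) * fps_X)) $ k = rank_gen_fun (level S deg) $ k"
      by (cases k) (simp_all add: rank_gen_fun_def card_0 card_Suc)
  qed
  show "graded_cancel_monoid S' prd' (e, []) deg'"
  proof (unfold_locales, goal_cases)
    case (6 x y z)
    then show ?case
      using left_cancel by (auto simp: S'_def prd'_def)
  next
    case (9 x k)
    then obtain m l where x: "x = (m, l)" "m \<in> S" "l \<in> lists {..<b}" "deg m + length l = Suc k"
      by (auto simp: S'_def deg'_def)
    \<comment> \<open>The right factor of degree one is the last letter of the word if there is one;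
      otherwise it comes from \<open>S\<close>.\<close>
    show ?case
    proof (cases l rule: rev_cases)
      case Nil
      then obtain u v where "u \<in> S" "v \<in> S" "deg u = k" "deg v = 1" "m = u \<cdot> v"
        using generated[of m k] x by auto
      then show ?thesis
        using x Nil
        by (intro bexI[of _ "(u, [])"] bexI[of _ "(v, [])"]) (auto simp: S'_def prd'_def deg'_def)
    next
      case (snoc l' c)
      then show ?thesis
        using x
        by (intro bexI[of _ "(m, l')"] bexI[of _ "(e, [c])"]) (auto simp: S'_def prd'_def deg'_def)
    qed
  qed (auto simp: S'_def prd'_def deg'_def assoc deg_0 fin[unfolded S'_def deg'_def])
qed

text \<open>
  The pair \<open>(m, 0)\<close> encodes \<open>m\<close>, and \<open>(m, i)\<close> with \<open>i > 0\<close> encodes \<open>m y\<^sub>i\<close>.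
  The map \<open>\<phi>\<close> is the retraction sending every \<open>y\<^sub>i\<close> to \<open>x\<close>.
\<close>

lemma adjoin_generators:
  fixes x :: 'a and a :: nat
  assumes x: "x \<in> S" "deg x = 1"
  defines "S' \<equiv> S \<times> {..a}"
    and "\<phi> \<equiv> (\<lambda>(m, i::nat). if i = 0 then m else m \<cdot> x)"
  defines "prd' \<equiv> (\<lambda>u v. if v = (e, 0) then u else (\<phi> u \<cdot> fst v, snd v))"
    and "deg' \<equiv> (\<lambda>u. deg (\<phi> u))"
  shows "graded_cancel_monoid S' prd' (e, 0) deg'"
    and "rank_gen_fun (level S' deg')
      = rank_gen_fun (level S deg) * (1 + fps_const (of_nat a) * fps_X)"
proof -
  have phi_closed [simp]: "\<phi> u \<in> S" if "u \<in> S'" for u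
    using that x by (auto simp: S'_def \<phi>_def)
  have fst_closed [simp]: "fst u \<in> S" if "u \<in> S'" for u
    using that by (auto simp: S'_def)
  have closed: "prd' u v \<in> S'" if "u \<in> S'" "v \<in> S'" for u v
    using that phi_closed[OF that(1)] by (auto simp: S'_def prd'_def)
  have phi_e [simp]: "\<phi> (e, 0) = e"
    by (simp add: \<phi>_def)
  have e_S': "(e, 0) \<in> S'"
    by (simp add: S'_def)
  \<comment> \<open>\<open>\<phi>\<close> is a homomorphism to the old monoid. Additivity of
    \<open>deg'\<close> and associativity both rest on this.\<close>
  have phi_mult: "\<phi> (prd' u v) = \<phi> u \<cdot> \<phi> v" if "u \<in> S'" "v \<in> S'" for u v
  proof (cases "v = (e, 0)")
    case False
    then have "\<phi> (prd' u v) = \<phi> (\<phi> u \<cdot> fst v, snd v)"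
      by (simp add: prd'_def)
    also have "\<dots> = \<phi> u \<cdot> \<phi> v"
      using phi_closed[OF that(1)] that x by (cases v) (simp add: \<phi>_def S'_def assoc)
    finally show ?thesis .
  qed (use that in \<open>simp add: prd'_def\<close>)
  have left_unit: "prd' (e, 0) u = u" and right_unit: "prd' u (e, 0) = u" if "u \<in> S'" for u
    using that by (auto simp: prd'_def S'_def)
  have deg_mult': "deg' (prd' u v) = deg' u + deg' v" if "u \<in> S'" "v \<in> S'" for u v
    using that by (simp add: deg'_def phi_mult)
  have deg'_0: "u = (e, 0)" if "u \<in> S'" "deg' u = 0" for u
    using that x deg_0 by (auto simp: deg'_def \<phi>_def S'_def split: if_splits)
  have deg'_e: "deg' (e, 0) = 0"
    by (simp add: deg'_def)
  \<comment> \<open>The definition of \<open>prd'\<close> branches on whether the right argument is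
    the unit. Associativity therefore needs that a product with a nontrivial right factor is never
    the unit.\<close>
  have prd'_eq_e: "v = (e, 0)" if "u \<in> S'" "v \<in> S'" "prd' u v = (e, 0)" for u v
    using deg_mult'[OF that(1,2)] that deg'_0[OF that(2)] by (simp add: deg'_e)
  have lev_0: "level S' deg' 0 = level S deg 0 \<times> {0}"
    using x by (auto simp: level_def S'_def deg'_def \<phi>_def split: if_splits)
  \<comment> \<open>Every \<open>m\<close> of degree \<open>k\<close> contributes the
    \<open>a\<close> further elements \<open>m y\<^sub>i\<close> of degree
    \<open>k + 1\<close>.\<close>
  have lev_Suc: "level S' deg' (Suc k) = level S deg (Suc k) \<times> {0} \<union> level S deg k \<times> {1..a}" for k
    using x by (auto simp: level_def S'_def deg'_def \<phi>_def split: if_splits)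
  have fin: "finite (level S' deg' k)" for k
    by (cases k) (auto simp: lev_0 lev_Suc finite_level)
  have card_Suc: "card (level S' deg' (Suc k)) =
      card (level S deg (Suc k)) + a * card (level S deg k)" for k
    unfolding lev_Suc
    by (subst card_Un_disjoint) (auto simp: finite_level card_cartesian_product)
  show "rank_gen_fun (level S' deg')
      = rank_gen_fun (level S deg) * (1 + fps_const (of_nat a) * fps_X)" (is "_ = ?F * _")
  proof (rule fps_ext)
    fix k
    have "?F * (1 + fps_const (of_nat a) * fps_X) = ?F + fps_const (of_nat a) * (fps_X * ?F)"
      by (simp add: algebra_simps)
    then show "rank_gen_fun (level S' deg') $ k = (?F * (1 + fps_const (of_nat a) * fps_X)) $ k"
      by (cases k) (simp_all add: rank_gen_fun_def lev_0 card_Suc card_cartesian_product)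
  qed
  show "graded_cancel_monoid S' prd' (e, 0) deg'"
  proof (unfold_locales, goal_cases)
    case (3 u v w)
    show ?case
    proof (cases "v = (e, 0) \<or> w = (e, 0)")
      case True
      then show ?thesis
        using 3 by (auto simp: left_unit right_unit closed)
    next
      case False
      then have "prd' v w \<noteq> (e, 0)"
        using 3 prd'_eq_e by blast
      then have "prd' u (prd' v w) = (\<phi> u \<cdot> (\<phi> v \<cdot> fst w), snd w)"
        using False by (auto simp: prd'_def)
      moreover have "prd' (prd' u v) w = (\<phi> u \<cdot> \<phi> v \<cdot> fst w, snd w)"
        unfolding phi_mult[OF 3(1,2), symmetric] using False by (subst prd'_def) simp
      ultimately show ?thesis
        using 3 by (simp add: assoc)
    qed
  next
    case (6 u v w)
    \<comment> \<open>Equal degrees ensure that both products fall into the same branch of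
      \<open>prd'\<close>.\<close>
    then have "deg' v = deg' w"
      using deg_mult' by (metis add_left_cancel)
    then have "v = (e, 0) \<longleftrightarrow> w = (e, 0)"
      using 6 deg'_0 deg'_e by metis
    then show ?case
      using 6 left_cancel[of "\<phi> u" "fst v" "fst w"]
      by (cases "v = (e, 0)") (simp_all add: prd'_def prod_eq_iff[of v w])
  next
    case (9 u k)
    obtain m i where u: "u = (m, i)" "m \<in> S" "i \<le> a"
      using 9 by (auto simp: S'_def)
    show ?case
    proof (cases "i = 0")
      case True
      then obtain y z where "y \<in> S" "z \<in> S" "deg y = k" "deg z = 1" "m = y \<cdot> z"
        using generated[of m k] u 9 by (auto simp: deg'_def \<phi>_def)
      then show ?thesis
        using u True
        by (intro bexI[of _ "(y, 0)"] bexI[of _ "(z, 0)"]) (auto simp: S'_def prd'_def deg'_def \<phi>_def)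
    next
      case False
      \<comment> \<open>Here \<open>u\<close> is \<open>m y\<^sub>i\<close>, and the new generator
        \<open>y\<^sub>i\<close> itself is encoded as \<open>(e, i)\<close>.\<close>
      then show ?thesis
        using u 9 x
        by (intro bexI[of _ "(m, 0)"] bexI[of _ "(e, i)"]) (auto simp: S'_def prd'_def deg'_def \<phi>_def)
    qed
  qed (simp_all add: closed e_S' left_unit right_unit deg_mult' deg'_0 fin)
qed

end

section \<open>Realising the rational function\<close>

text \<open>The quotient \<open>N / D\<close> is expressed by a product, which postpones division to
  the very end. The element \<open>x\<close> of degree one is recorded because adjoining generators
  depends on one.\<close>

definition monoid_realizable :: "rat fps \<Rightarrow> rat fps \<Rightarrow> bool" where
  "monoid_realizable N D \<longleftrightarrow> (\<exists>(S :: nat set) prd e deg x.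
     graded_cancel_monoid S prd e deg \<and> x \<in> S \<and> deg x = 1 \<and> rank_gen_fun (level S deg) * D = N)"

lemma monoid_realizableI:
  fixes S :: "'a :: countable set"
  assumes "graded_cancel_monoid S prd e deg" "x \<in> S" "deg x = 1"
    and "rank_gen_fun (level S deg) * D = N"
  shows "monoid_realizable N D"
  unfolding monoid_realizable_def
  using graded_cancel_monoid.transfer_left_inverse[OF assms(1), of from_nat to_nat] assms(2-)
  by (intro exI[of _ "to_nat ` S"] exI[of _ "\<lambda>x y. to_nat (prd (from_nat x) (from_nat y))"]
      exI[of _ "to_nat e"] exI[of _ "deg \<circ> from_nat"] exI[of _ "to_nat x"]) simp

text \<open>The monoid is given explicitly, not through \<open>monoid_realizable\<close>, so that
  the trivial monoid, which has no element of degree one, is covered. The letter \<open>0\<close>,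
  present since \<open>b > 0\<close>, supplies such an element.\<close>

lemma realizable_times_free:
  fixes S :: "nat set"
  assumes "graded_cancel_monoid S prd e deg" "b > 0" "rank_gen_fun (level S deg) * D = N"
  shows "monoid_realizable N (D * (1 - fps_const (of_nat b) * fps_X))"
proof -
  interpret graded_cancel_monoid S prd e deg by fact
  show ?thesis
  proof (rule monoid_realizableI[OF times_free_monoid(1)[of b], of "(e, [0])"])
    show "rank_gen_fun (level (S \<times> lists {..<b}) (\<lambda>(m, l). deg m + length l)) *
        (D * (1 - fps_const (of_nat b) * fps_X)) = N"
      unfolding assms(3)[symmetric] times_free_monoid(2)[of b, symmetric]
      by (simp only: mult_ac)
  qed (use \<open>b > 0\<close> in auto)
qed

text \<open>The witness is a product of \<open>m\<close> free monoids, built up from the trivial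
  monoid, whose growth series is \<open>1\<close>. Since \<open>m \<ge> 1\<close>, it contains a
  letter.\<close>

lemma realizable_denominator:
  fixes m :: nat
  assumes "m \<ge> 1" "\<And>j. j \<in> {1..m} \<Longrightarrow> b j > (0::nat)"
  shows "monoid_realizable 1 (\<Prod>j=1..m. 1 - fps_const (of_nat (b j)) * fps_X)"
  using assms
proof (induction m rule: nat_induct_at_least)
  case base
  have lev: "level {0} (\<lambda>_. 0) k = (if k = 0 then {0::nat} else {})" for k
    by (auto simp: level_def)
  have "graded_cancel_monoid {0::nat} (+) 0 (\<lambda>_. 0)"
    by unfold_locales (auto simp: lev)
  moreover have "rank_gen_fun (level {0::nat} (\<lambda>_. 0)) * 1 = 1"
    by (rule fps_ext) (simp add: rank_gen_fun_def lev)
  ultimately show ?case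
    using realizable_times_free[of "{0}" "(+)" 0 "\<lambda>_. 0" "b 1" 1 1] base by simp
next
  case (Suc m)
  then have "monoid_realizable 1 (\<Prod>j=1..m. 1 - fps_const (of_nat (b j)) * fps_X)"
    by simp
  then obtain S :: "nat set" and prd e deg where "graded_cancel_monoid S prd e deg"
    "rank_gen_fun (level S deg) * (\<Prod>j=1..m. 1 - fps_const (of_nat (b j)) * fps_X) = 1"
    by (auto simp only: monoid_realizable_def)
  then have "monoid_realizable 1 ((\<Prod>j=1..m. 1 - fps_const (of_nat (b j)) * fps_X) *
      (1 - fps_const (of_nat (b (Suc m))) * fps_X))"
    using Suc.prems by (intro realizable_times_free) auto
  then show ?case
    by simp
qed

lemma realizable_adjoin:
  assumes "monoid_realizable N D"
  shows "monoid_realizable (N * (1 + fps_const (of_nat a) * fps_X)) D"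
proof -
  obtain S :: "nat set" and prd e deg x
    where M: "graded_cancel_monoid S prd e deg" and x: "x \<in> S" "deg x = 1"
      and F: "rank_gen_fun (level S deg) * D = N"
    using assms by (auto simp: monoid_realizable_def)
  interpret graded_cancel_monoid S prd e deg by fact
  \<comment> \<open>The old \<open>x\<close>, now encoded as \<open>(x, 0)\<close>, keeps degree one
    and is available for the next adjunction.\<close>
  show ?thesis
  proof (rule monoid_realizableI[OF adjoin_generators(1)[OF x, of a], of "(x, 0)"])
    show "rank_gen_fun (level (S \<times> {..a}) (\<lambda>u. deg ((\<lambda>(m, i). if i = 0 then m else prd m x) u))) * D
        = N * (1 + fps_const (of_nat a) * fps_X)"
      unfolding F[symmetric] adjoin_generators(2)[OF x, of a] by (simp only: mult_ac)
  qed (use x in auto)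
qed

lemma realizable_numerator:
  fixes n :: nat
  assumes "monoid_realizable 1 D"
  shows "monoid_realizable (\<Prod>i=1..n. 1 + fps_const (of_nat (a i)) * fps_X) D"
  using assms by (induction n) (simp_all add: realizable_adjoin)

theorem theorem1p3:
  fixes n m :: nat and a b :: "nat \<Rightarrow> nat"
  assumes "m \<ge> 1"
    and "\<And>i. i \<in> {1..n} \<Longrightarrow> a i > 0"
    and "\<And>j. j \<in> {1..m} \<Longrightarrow> b j > 0"
  shows "\<exists>(P :: nat set) (r :: nat rel) (R :: nat \<Rightarrow> nat set).
           upho P r R \<and>
           rank_gen_fun R =
             (\<Prod>i=1..n. 1 + fps_const (of_nat (a i)) * fps_X) /
             (\<Prod>j=1..m. 1 - fps_const (of_nat (b j)) * fps_X)"
proof -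
  define N :: "rat fps" where "N = (\<Prod>i=1..n. 1 + fps_const (of_nat (a i)) * fps_X)"
  define D :: "rat fps" where "D = (\<Prod>j=1..m. 1 - fps_const (of_nat (b j)) * fps_X)"
  have "monoid_realizable N D"
    unfolding N_def D_def using assms by (intro realizable_numerator realizable_denominator)
  then obtain S :: "nat set" and prd e deg
    where M: "graded_cancel_monoid S prd e deg" and F: "rank_gen_fun (level S deg) * D = N"
    by (auto simp: monoid_realizable_def)
  \<comment> \<open>Each factor of \<open>D\<close> has constant term \<open>1\<close> and is thus
    nonzero, so \<open>D\<close> can be cancelled.\<close>
  have "(1 - fps_const (of_nat (b j)) * fps_X :: rat fps) $ 0 = 1" for j
    by simp
  then have "D \<noteq> 0"
    unfolding D_def by (metis (no_types, lifting) fps_zero_nth prod_zero_iff finite_atLeastAtMost zero_neq_one)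
  then have "rank_gen_fun (level S deg) = N / D"
    unfolding F[symmetric] by simp
  then show ?thesis
    using graded_cancel_monoid.ldvd_upho[OF M] unfolding N_def D_def by blast
qed

end
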